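(* Let $(\mathcal{L},[.,.],\alpha)$ be a multiplicative Hom-Leibniz algebra over $\mathbb{K}$ and let $(M,\gamma)$ be a representation of it. For the spaces $\mathcal{C}^n(\mathcal{L},M)$ and the $\mathbb{K}$-linear maps $\delta^n:\mathcal{C}^n(\mathcal{L},M)\to\mathcal{C}^{n+1}(\mathcal{L},M)$ described in the context, one has $\delta^{n+1}\circ\delta^n=0$ for every $n\ge 1$. Therefore $(\mathcal{C}^{\ast}(\mathcal{L},M),\delta)$ is a cochain complex.
   Context: $\mathbb{K}$ is an algebraically closed field of characteristic $0$. A (multiplicative) Hom-Leibniz algebra $(\mathcal{L},[.,.],\alpha)$ is a $\mathbb{K}$-vector space with a bilinear bracket $[.,.]:\mathcal{L}\times\mathcal{L}\to\mathcal{L}$ and a linear map $\alpha:\mathcal{L}\to\mathcal{L}$ such that $[\alpha(x),[y,z]]=[[x,y],\alpha(z)]-[[x,z],\alpha(y)]$ and $\alpha([x,y])=[\alpha(x),\alpha(y)]$ for all $x,y,z\in\mathcal{L}$. A representation $(M,\gamma)$ is a $\mathbb{K}$-vector space $M$ with a linear map $\gamma:M\to M$ and two bilinear actions, also written $[.,.]:\mathcal{L}\times M\to M$ and $[.,.]:M\times\mathcal{L}\to M$, such that $[\alpha(l),\gamma(m)]=\gamma([l,m])$ and $[\gamma(m),\alpha(l)]=\gamma([m,l])$ for $l\in\mathcal{L}$, $m\in M$, and such that $[\tau(x),[y,z]]=[[x,y],\tau(z)]-[[x,z],\tau(y)]$ holds whenever one of $x,y,z$ is in $M$ and the two others are in $\mathcal{L}$,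 where $\tau=\alpha$ on elements of $\mathcal{L}$ and $\tau=\gamma$ on elements of $M$. $\mathcal{C}^n(\mathcal{L},M)$ is the space of $n$-linear maps $\varphi:\mathcal{L}^n\to M$ with $\gamma(\varphi(x_0,\dots,x_{n-1}))=\varphi(\alpha(x_0),\dots,\alpha(x_{n-1}))$ for all $x_0,\dots,x_{n-1}\in\mathcal{L}$. The map $\delta^n$ is $$\delta^n\varphi(x_1,\dots,x_{n+1})=[\alpha^{n-1}(x_1),\varphi(x_2,\dots,x_{n+1})]+\sum_{i=2}^{n+1}(-1)^i[\varphi(x_1,\dots,\widehat{x_i},\dots,x_{n+1}),\alpha^{n-1}(x_i)]$$ $$+\sum_{1\le i<j\le n+1}(-1)^{j+1}\varphi(\alpha(x_1),\dots,\alpha(x_{i-1}),[x_i,x_j],\alpha(x_{i+1}),\dots,\widehat{x_j},\dots,\alpha(x_{n+1})),$$ where $\widehat{x_i}$ means that $x_i$ is omitted. *)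

theory Defs
  imports
    "HOL-Computational_Algebra.Polynomial"
    "HOL-Library.Function_Algebras"
    "HOL-Library.FuncSet"
begin

definition bilinear_map ::
  "('k::field \<Rightarrow> 'a::ab_group_add \<Rightarrow> 'a) \<Rightarrow> ('k \<Rightarrow> 'b::ab_group_add \<Rightarrow> 'b) \<Rightarrow>
   ('k \<Rightarrow> 'c::ab_group_add \<Rightarrow> 'c) \<Rightarrow> ('a \<Rightarrow> 'b \<Rightarrow> 'c) \<Rightarrow> bool" where
  "bilinear_map s1 s2 s3 f \<longleftrightarrow>
     (\<forall>x. Vector_Spaces.linear s2 s3 (\<lambda>y. f x y)) \<and>
     (\<forall>y. Vector_Spaces.linear s1 s3 (\<lambda>x. f x y))"

text \<open>All algebras are multiplicative; the vector space \<open>L\<close> is the whole type \<open>'l\<close>.\<close>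

locale hom_leibniz_algebra =
  vector_space scaleL
  for scaleL :: "'k::field \<Rightarrow> 'l::ab_group_add \<Rightarrow> 'l" +
  fixes br :: "'l \<Rightarrow> 'l \<Rightarrow> 'l"
    and \<alpha> :: "'l \<Rightarrow> 'l"
  assumes br_bilinear: "bilinear_map scaleL scaleL scaleL br"
    and \<alpha>_linear: "Vector_Spaces.linear scaleL scaleL \<alpha>"
    and hom_leibniz: "br (\<alpha> x) (br y z) = br (br x y) (\<alpha> z) - br (br x z) (\<alpha> y)"
    and \<alpha>_br: "\<alpha> (br x y) = br (\<alpha> x) (\<alpha> y)"

text \<open>\<open>lact l m\<close> and \<open>ract m l\<close> are the actions \<open>[l, m]\<close> and \<open>[m, l]\<close>. The last three
  assumptions are the Hom-Leibniz identity with its third, second and first argument in \<open>M\<close>.\<close>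

locale hom_leibniz_representation =
  hom_leibniz_algebra scaleL br \<alpha> + M: vector_space scaleM
  for scaleL :: "'k::field \<Rightarrow> 'l::ab_group_add \<Rightarrow> 'l"
    and br :: "'l \<Rightarrow> 'l \<Rightarrow> 'l"
    and \<alpha> :: "'l \<Rightarrow> 'l"
    and scaleM :: "'k \<Rightarrow> 'm::ab_group_add \<Rightarrow> 'm" +
  fixes \<gamma> :: "'m \<Rightarrow> 'm"
    and lact :: "'l \<Rightarrow> 'm \<Rightarrow> 'm"
    and ract :: "'m \<Rightarrow> 'l \<Rightarrow> 'm"
  assumes \<gamma>_linear: "Vector_Spaces.linear scaleM scaleM \<gamma>"
    and lact_bilinear: "bilinear_map scaleL scaleM scaleM lact"
    and ract_bilinear: "bilinear_map scaleM scaleL scaleM ract"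
    and \<gamma>_lact: "lact (\<alpha> l) (\<gamma> m) = \<gamma> (lact l m)"
    and \<gamma>_ract: "ract (\<gamma> m) (\<alpha> l) = \<gamma> (ract m l)"
    and rep_LLM: "lact (\<alpha> x) (lact y m) = lact (br x y) (\<gamma> m) - ract (lact x m) (\<alpha> y)"
    and rep_LML: "lact (\<alpha> x) (ract m z) = ract (lact x m) (\<alpha> z) - lact (br x z) (\<gamma> m)"
    and rep_MLL: "ract (\<gamma> m) (br y z) = ract (ract m y) (\<alpha> z) - ract (ract m z) (\<alpha> y)"

text \<open>A map \<open>L\<^sup>n \<rightarrow> M\<close> is a function on lists, of interest only on lists of length \<open>n\<close>. Cochains are
  required to vanish on all other lists, so that equality of cochains is equality of functions.\<close>

definition multilinear ::
  "('k::field \<Rightarrow> 'l::ab_group_add \<Rightarrow> 'l) \<Rightarrow> ('k \<Rightarrow> 'm::ab_group_add \<Rightarrow> 'm) \<Rightarrow>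
   nat \<Rightarrow> ('l list \<Rightarrow> 'm) \<Rightarrow> bool" where
  "multilinear scaleL scaleM n \<phi> \<longleftrightarrow>
     (\<forall>xs k. length xs = n \<longrightarrow> k < n \<longrightarrow>
        Vector_Spaces.linear scaleL scaleM (\<lambda>x. \<phi> (xs[k := x])))"

definition cochains ::
  "('k::field \<Rightarrow> 'l::ab_group_add \<Rightarrow> 'l) \<Rightarrow> ('l \<Rightarrow> 'l) \<Rightarrow>
   ('k \<Rightarrow> 'm::ab_group_add \<Rightarrow> 'm) \<Rightarrow> ('m \<Rightarrow> 'm) \<Rightarrow> nat \<Rightarrow> ('l list \<Rightarrow> 'm) set" where
  "cochains scaleL \<alpha> scaleM \<gamma> n =
     {\<phi>. multilinear scaleL scaleM n \<phi> \<and>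
         (\<forall>xs. length xs = n \<longrightarrow> \<gamma> (\<phi> xs) = \<phi> (map \<alpha> xs)) \<and>
         (\<forall>xs. length xs \<noteq> n \<longrightarrow> \<phi> xs = 0)}"

definition scale_fun :: "('k \<Rightarrow> 'm \<Rightarrow> 'm) \<Rightarrow> 'k \<Rightarrow> ('x \<Rightarrow> 'm) \<Rightarrow> 'x \<Rightarrow> 'm" where
  "scale_fun scaleM c \<phi> = (\<lambda>x. scaleM c (\<phi> x))"

text \<open>Positions in a tuple are counted from \<open>1\<close>, so \<open>x\<^sub>i\<close> is \<open>entry xs i\<close>.\<close>

definition entry :: "'l list \<Rightarrow> nat \<Rightarrow> 'l" where
  "entry xs i = xs ! (i - 1)"

definition omit :: "nat \<Rightarrow> 'l list \<Rightarrow> 'l list" where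
  "omit i xs = take (i - 1) xs @ drop i xs"

text \<open>For \<open>i < j\<close>, \<open>contract br \<alpha> i j xs\<close> is the tuple
  \<open>(\<alpha> x\<^sub>1, \<dots>, \<alpha> x\<^sub>i\<^sub>-\<^sub>1, [x\<^sub>i, x\<^sub>j], \<alpha> x\<^sub>i\<^sub>+\<^sub>1, \<dots>, \<alpha> x\<^sub>n\<^sub>+\<^sub>1)\<close> with its \<open>j\<close>-th entry omitted.\<close>

definition contract :: "('l \<Rightarrow> 'l \<Rightarrow> 'l) \<Rightarrow> ('l \<Rightarrow> 'l) \<Rightarrow> nat \<Rightarrow> nat \<Rightarrow> 'l list \<Rightarrow> 'l list" where
  "contract br \<alpha> i j xs = omit j ((map \<alpha> xs)[i - 1 := br (entry xs i) (entry xs j)])"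

text \<open>Meaningful for \<open>n \<ge> 1\<close> only, because of the exponent \<open>n - 1\<close>.\<close>

definition coboundary ::
  "('l \<Rightarrow> 'l \<Rightarrow> 'l) \<Rightarrow> ('l \<Rightarrow> 'l) \<Rightarrow> ('k::field \<Rightarrow> 'm::ab_group_add \<Rightarrow> 'm) \<Rightarrow>
   ('l \<Rightarrow> 'm \<Rightarrow> 'm) \<Rightarrow> ('m \<Rightarrow> 'l \<Rightarrow> 'm) \<Rightarrow> nat \<Rightarrow> ('l list \<Rightarrow> 'm) \<Rightarrow> 'l list \<Rightarrow> 'm" where
  "coboundary br \<alpha> scaleM lact ract n \<phi> xs =
     (if length xs = n + 1 then
        lact ((\<alpha> ^^ (n - 1)) (entry xs 1)) (\<phi> (omit 1 xs))
        + (\<Sum>i = 2..n + 1.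
             scaleM ((-1) ^ i) (ract (\<phi> (omit i xs)) ((\<alpha> ^^ (n - 1)) (entry xs i))))
        + (\<Sum>(i, j) \<in> {(i, j). 1 \<le> i \<and> i < j \<and> j \<le> n + 1}.
             scaleM ((-1) ^ (j + 1)) (\<phi> (contract br \<alpha> i j xs)))
      else 0)"

text \<open>A cochain complex \<open>C\<^sup>1 \<rightarrow> C\<^sup>2 \<rightarrow> \<dots>\<close> starting in degree \<open>1\<close>, whose terms are subspaces of one
  ambient vector space. Nothing is required of \<open>C 0\<close> and \<open>d 0\<close>.\<close>

definition cochain_complex ::
  "('k::field \<Rightarrow> 'v::ab_group_add \<Rightarrow> 'v) \<Rightarrow> (nat \<Rightarrow> 'v set) \<Rightarrow> (nat \<Rightarrow> 'v \<Rightarrow> 'v) \<Rightarrow> bool" where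
  "cochain_complex scale C d \<longleftrightarrow>
     vector_space scale \<and>
     (\<forall>n\<ge>1. module.subspace scale (C n)) \<and>
     (\<forall>n\<ge>1. d n \<in> C n \<rightarrow> C (n + 1)) \<and>
     (\<forall>n\<ge>1. \<forall>\<phi>\<in>C n. \<forall>\<psi>\<in>C n. d n (\<phi> + \<psi>) = d n \<phi> + d n \<psi>) \<and>
     (\<forall>n\<ge>1. \<forall>c. \<forall>\<phi>\<in>C n. d n (scale c \<phi>) = scale c (d n \<phi>)) \<and>
     (\<forall>n\<ge>1. \<forall>\<phi>\<in>C n. d (n + 1) (d n \<phi>) = 0)"

end

theory Submission
  imports Defs
begin

text \<open>
  The right action makes the last argument of a cochain special, so \<open>\<delta>\<delta> = 0\<close> is proved by induction on
  the number of arguments, splitting off the last one. For \<open>\<alpha> = id\<close> this is Cartan calculus: if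
  \<open>i\<^sub>y \<phi> = \<phi>(\<dots>, y)\<close> is insertion in the last slot and \<open>\<Theta>\<^sub>y \<phi>\<close> is the Lie derivative
  \<open>xs \<mapsto> [\<phi>(xs), y] - \<Sum>\<^sub>i \<phi>(\<dots>, [x\<^sub>i, y], \<dots>)\<close>, then on tuples of length \<open>n \<ge> 1\<close>
  \<open>i\<^sub>y \<delta> = \<delta> i\<^sub>y + (-1)\<^sup>n\<^sup>+\<^sup>1 \<Theta>\<^sub>y\<close>. Applying this twice gives
  \<open>i\<^sub>y \<delta>\<delta> = \<delta>\<delta> i\<^sub>y \<plusminus> (\<delta> \<Theta>\<^sub>y - \<Theta>\<^sub>y \<delta>)\<close>, where the sign depends on \<open>n\<close>, so it suffices that
  \<open>\<delta>\<close> commutes with \<open>\<Theta>\<^sub>y\<close>. That in turn follows by the same induction from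
  \<open>i\<^sub>z \<Theta>\<^sub>y = \<Theta>\<^sub>y i\<^sub>z - i\<^bsub>[z, y]\<^esub>\<close> and \<open>\<Theta>\<^sub>z \<Theta>\<^sub>y - \<Theta>\<^sub>y \<Theta>\<^sub>z = - \<Theta>\<^bsub>[z, y]\<^esub>\<close>. Each identity
  of Leibniz type is used in one place: the Leibniz identity of the algebra and the axiom for
  \<open>[m, [y, z]]\<close> in the commutator of Lie derivatives, the axiom for \<open>[x, [m, z]]\<close> in the base case of \<open>\<delta> \<Theta>\<^sub>y = \<Theta>\<^sub>y \<delta>\<close>, and the axiom for
  \<open>[x, [y, m]]\<close> in the base case of \<open>\<delta>\<delta> = 0\<close>. Both base cases concern cochains without arguments, that is,
  elements of \<open>M\<close>.

  With a twist, \<open>i\<^sub>y \<phi>\<close> no longer intertwines \<open>\<alpha>\<close> and \<open>\<gamma>\<close>, since \<open>\<gamma>(\<phi>(xs, y)) = \<phi>(\<alpha> xs, \<alpha> y)\<close>: the terms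
  of \<open>\<delta>\<phi>(xs, y)\<close> with an action insert \<open>y\<close> in \<open>\<phi>\<close>, those with a contracted bracket insert \<open>\<alpha> y\<close>. The
  induction therefore runs over pairs \<open>(\<phi>, \<psi>)\<close> with \<open>\<gamma>(\<phi>(xs)) = \<psi>(\<alpha> xs)\<close>, a class that is stable under
  \<open>(\<phi>, \<psi>) \<mapsto> (i\<^sub>y \<phi>, i\<^bsub>\<alpha> y\<^esub> \<psi>)\<close>. The operator \<open>\<partial> k \<phi> \<psi>\<close> uses \<open>\<phi>\<close> in the action terms, \<open>\<psi>\<close> in the
  contraction terms, and an exponent \<open>k\<close> of \<open>\<alpha>\<close> that is independent of the number of arguments;
  \<open>\<delta>\<^sup>n \<phi>\<close> is \<open>\<partial> (n - 1) \<phi> \<phi>\<close>. A composite of two such operators involves a chain \<open>\<phi>, \<psi>, \<chi>\<close> in which both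
  neighbouring pairs are intertwined, and it raises the exponent by one: \<open>\<delta>\<delta> = 0\<close> becomes
  \<open>\<partial> (k + 1) (\<partial> k \<phi> \<psi>) (\<partial> k \<psi> \<chi>) = 0\<close>.
\<close>

section \<open>Linearity and powers of the twist\<close>

context hom_leibniz_representation
begin

lemma linearity:
  shows br_add_left: "br (x + x') y = br x y + br x' y"
    and br_scale_left: "br (scaleL c x) y = scaleL c (br x y)"
    and br_add_right: "br z (x + x') = br z x + br z x'"
    and br_scale_right: "br z (scaleL c x) = scaleL c (br z x)"
    and \<alpha>_add: "\<alpha> (x + x') = \<alpha> x + \<alpha> x'"
    and \<alpha>_scale: "\<alpha> (scaleL c x) = scaleL c (\<alpha> x)"
    and \<gamma>_add: "\<gamma> (m + m') = \<gamma> m + \<gamma> m'"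
    and \<gamma>_scale: "\<gamma> (scaleM c m) = scaleM c (\<gamma> m)"
    and lact_add_left: "lact (x + x') m = lact x m + lact x' m"
    and lact_scale_left: "lact (scaleL c x) m = scaleM c (lact x m)"
    and lact_add_right: "lact x (m + m') = lact x m + lact x m'"
    and lact_scale_right: "lact x (scaleM c m) = scaleM c (lact x m)"
    and ract_add_left: "ract (m + m') x = ract m x + ract m' x"
    and ract_scale_left: "ract (scaleM c m) x = scaleM c (ract m x)"
    and ract_add_right: "ract m (x + x') = ract m x + ract m x'"
    and ract_scale_right: "ract m (scaleL c x) = scaleM c (ract m x)"
  using br_bilinear \<alpha>_linear \<gamma>_linear lact_bilinear ract_bilinear
  by (simp_all add: bilinear_map_def Vector_Spaces.linear_iff)

lemma ract_diff_left: "ract (m - m') x = ract m x - ract m' x"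
  using ract_add_left[of "m - m'" m' x] by (simp add: algebra_simps)

lemma ract_sum_left: "finite I \<Longrightarrow> ract (\<Sum>i\<in>I. f i) x = (\<Sum>i\<in>I. ract (f i) x)"
proof (induction I rule: finite_induct)
  case empty
  then show ?case using ract_diff_left[of 0 0 x] by simp
qed (simp add: ract_add_left)

lemma \<gamma>_diff: "\<gamma> (m - m') = \<gamma> m - \<gamma> m'"
  using \<gamma>_add[of "m - m'" m'] by (simp add: algebra_simps)

lemma \<gamma>_sum: "finite I \<Longrightarrow> \<gamma> (\<Sum>i\<in>I. f i) = (\<Sum>i\<in>I. \<gamma> (f i))"
proof (induction I rule: finite_induct)
  case empty
  then show ?case using \<gamma>_diff[of 0 0] by simp
qed (simp add: \<gamma>_add)

lemma \<alpha>_pow_br: "(\<alpha> ^^ k) (br x y) = br ((\<alpha> ^^ k) x) ((\<alpha> ^^ k) y)"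
  by (induction k) (simp_all add: \<alpha>_br)

lemma \<alpha>_pow_\<alpha>: "(\<alpha> ^^ k) (\<alpha> x) = \<alpha> ((\<alpha> ^^ k) x)"
  by (simp add: funpow_swap1)

lemma \<alpha>_pow_add: "(\<alpha> ^^ k) (x + y) = (\<alpha> ^^ k) x + (\<alpha> ^^ k) y"
  by (induction k) (simp_all add: \<alpha>_add)

lemma \<alpha>_pow_scale: "(\<alpha> ^^ k) (scaleL c x) = scaleL c ((\<alpha> ^^ k) x)"
  by (induction k) (simp_all add: \<alpha>_scale)

section \<open>The coboundary of a pair and the Lie derivative\<close>

text \<open>The coboundary formula on \<open>length xs\<close> arguments, with the two roles of the cochain separated and
  the exponent \<open>k\<close> of the twist left free.\<close>

definition twisted_coboundary ::
  "nat \<Rightarrow> ('l list \<Rightarrow> 'm) \<Rightarrow> ('l list \<Rightarrow> 'm) \<Rightarrow> 'l list \<Rightarrow> 'm"  (\<open>\<partial>\<close>) where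
  "\<partial> k \<phi> \<psi> xs =
     lact ((\<alpha> ^^ k) (entry xs 1)) (\<phi> (omit 1 xs))
     + (\<Sum>i = 2..length xs. scaleM ((-1) ^ i) (ract (\<phi> (omit i xs)) ((\<alpha> ^^ k) (entry xs i))))
     + (\<Sum>(i, j) \<in> {(i, j). 1 \<le> i \<and> i < j \<and> j \<le> length xs}.
          scaleM ((-1) ^ (j + 1)) (\<psi> (contract br \<alpha> i j xs)))"

text \<open>The right action of \<open>y\<close> on cochains: it acts on the value, and on the arguments with the opposite
  sign. The cochain is split into \<open>\<phi>\<close> and \<open>\<psi>\<close> for the same reason as in \<open>\<partial>\<close>.\<close>

definition lie_derivative ::
  "nat \<Rightarrow> 'l \<Rightarrow> ('l list \<Rightarrow> 'm) \<Rightarrow> ('l list \<Rightarrow> 'm) \<Rightarrow> 'l list \<Rightarrow> 'm"  (\<open>\<Theta>\<close>) where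
  "\<Theta> k y \<phi> \<psi> xs =
     ract (\<phi> xs) ((\<alpha> ^^ k) y) - (\<Sum>i<length xs. \<psi> ((map \<alpha> xs)[i := br (xs ! i) y]))"

lemma twisted_coboundary_singleton: "\<partial> k \<phi> \<psi> [x] = lact ((\<alpha> ^^ k) x) (\<phi> [])"
proof -
  have "{(i, j). 1 \<le> i \<and> i < j \<and> j \<le> length [x]} = {}" by auto
  then show ?thesis unfolding twisted_coboundary_def by (simp only: sum.empty) (simp add: entry_def omit_def)
qed

text \<open>Terms in which the last argument neither acts nor is absorbed by a bracket form the coboundary of
  the pair with that argument inserted; a contraction applies \<open>\<alpha>\<close> to it, whence \<open>\<alpha> y\<close> next to \<open>\<psi>\<close>.
  All remaining terms carry the index of \<open>y\<close> as position of the omitted entry, hence a common sign, and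
  add up to the Lie derivative. Together with the value on singletons this determines \<open>\<partial>\<close>, so that
  properties of \<open>\<partial>\<close> follow by induction without returning to the sums.\<close>

lemma twisted_coboundary_snoc:
  assumes "xs \<noteq> []"
  shows "\<partial> k \<phi> \<psi> (xs @ [y]) =
    \<partial> k (\<lambda>zs. \<phi> (zs @ [y])) (\<lambda>zs. \<psi> (zs @ [\<alpha> y])) xs
    + scaleM ((-1) ^ Suc (length xs)) (\<Theta> k y \<phi> \<psi> xs)"
proof -
  define n where "n = length xs"
  have n: "n \<ge> 1" using assms by (cases xs) (auto simp: n_def)
  let ?P = "\<lambda>n. {(i, j). 1 \<le> i \<and> i < j \<and> j \<le> (n::nat)}"
  let ?ys = "xs @ [y]"
  let ?R = "\<lambda>i. scaleM ((-1) ^ i) (ract (\<phi> (omit i ?ys)) ((\<alpha> ^^ k) (entry ?ys i)))"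
  let ?C = "\<lambda>(i, j). scaleM ((-1) ^ (j + 1)) (\<psi> (contract br \<alpha> i j ?ys))"
  have entry_snoc: "entry ?ys i = entry xs i" if "1 \<le> i" "i \<le> n" for i
    using that by (simp add: entry_def n_def nth_append less_eq_Suc_le)
  have omit_snoc: "omit i ?ys = omit i xs @ [y]" if "i \<le> n" for i
    using that by (simp add: omit_def n_def)
  have fin: "finite (?P n)"
    by (rule finite_subset[of _ "{..n} \<times> {..n}"]) auto
  have split: "?P (Suc n) = ?P n \<union> (\<lambda>i. (Suc i, Suc n)) ` {..<n}"
  proof (intro equalityI subsetI)
    fix p assume "p \<in> ?P (Suc n)"
    then obtain i j where p: "p = (i, j)" "1 \<le> i" "i < j" "j \<le> Suc n" by auto
    show "p \<in> ?P n \<union> (\<lambda>i. (Suc i, Suc n)) ` {..<n}"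
    proof (cases "j = Suc n")
      case True
      then have "p = (Suc (i - 1), Suc n)" "i - 1 < n" using p by auto
      then show ?thesis by blast
    qed (use p in auto)
  qed auto
  have "sum ?R {2..Suc n} = sum ?R {2..n} + ?R (Suc n)"
    using n by (simp add: sum.nat_ivl_Suc')
  also have "sum ?R {2..n} = (\<Sum>i = 2..n.
      scaleM ((-1) ^ i) (ract (\<phi> (omit i xs @ [y])) ((\<alpha> ^^ k) (entry xs i))))"
    by (rule sum.cong) (auto simp: entry_snoc omit_snoc)
  also have "?R (Suc n) = scaleM ((-1) ^ Suc n) (ract (\<phi> xs) ((\<alpha> ^^ k) y))"
    by (simp add: omit_def entry_def n_def)
  finally have R: "sum ?R {2..Suc n} = (\<Sum>i = 2..n.
      scaleM ((-1) ^ i) (ract (\<phi> (omit i xs @ [y])) ((\<alpha> ^^ k) (entry xs i))))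
      + scaleM ((-1) ^ Suc n) (ract (\<phi> xs) ((\<alpha> ^^ k) y))" .
  have "sum ?C (?P (Suc n)) = sum ?C (?P n) + sum ?C ((\<lambda>i. (Suc i, Suc n)) ` {..<n})"
    unfolding split by (rule sum.union_disjoint) (use fin in auto)
  also have "sum ?C (?P n) = (\<Sum>(i, j) \<in> ?P n.
      scaleM ((-1) ^ (j + 1)) (\<psi> (contract br \<alpha> i j xs @ [\<alpha> y])))"
  proof (rule sum.cong[OF refl], clarify)
    fix i j assume ij: "1 \<le> i" "i < j" "j \<le> n"
    have "contract br \<alpha> i j ?ys = contract br \<alpha> i j xs @ [\<alpha> y]"
      using ij entry_snoc[of i] entry_snoc[of j]
      by (simp add: contract_def omit_def list_update_append1 n_def)
    then show "scaleM ((-1) ^ (j + 1)) (\<psi> (contract br \<alpha> i j ?ys)) =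
      scaleM ((-1) ^ (j + 1)) (\<psi> (contract br \<alpha> i j xs @ [\<alpha> y]))" by simp
  qed
  also have "sum ?C ((\<lambda>i. (Suc i, Suc n)) ` {..<n}) =
      (\<Sum>i<n. scaleM ((-1) ^ n) (\<psi> ((map \<alpha> xs)[i := br (xs ! i) y])))"
  proof (subst sum.reindex, force simp: inj_on_def, rule sum.cong[OF refl])
    fix i assume i: "i \<in> {..<n}"
    have "contract br \<alpha> (Suc i) (Suc n) ?ys = (map \<alpha> xs)[i := br (xs ! i) y]"
      using i by (simp add: contract_def omit_def entry_def n_def nth_append list_update_append1)
    then show "(?C \<circ> (\<lambda>i. (Suc i, Suc n))) i =
        scaleM ((-1) ^ n) (\<psi> ((map \<alpha> xs)[i := br (xs ! i) y]))" by simp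
  qed
  finally have C: "sum ?C (?P (Suc n)) = (\<Sum>(i, j) \<in> ?P n.
      scaleM ((-1) ^ (j + 1)) (\<psi> (contract br \<alpha> i j xs @ [\<alpha> y])))
      - scaleM ((-1) ^ Suc n) (\<Sum>i<n. \<psi> ((map \<alpha> xs)[i := br (xs ! i) y]))"
    by (simp add: M.scale_sum_right sum_negf)
  have len: "length ?ys = Suc n" by (simp add: n_def)
  show ?thesis
    unfolding twisted_coboundary_def[of k \<phi> \<psi>] len R C lie_derivative_def twisted_coboundary_def[of k "\<lambda>zs. \<phi> (zs @ [y])"]
      n_def[symmetric]
    using n by (simp add: entry_snoc omit_snoc M.scale_right_diff_distrib algebra_simps)
qed

text \<open>The insertion rule \<open>i\<^sub>z \<Theta>\<^sub>y = \<Theta>\<^sub>y i\<^sub>z - i\<^bsub>[z, y]\<^esub>\<close>: the extra term is the action of \<open>y\<close> on the inserted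
  argument itself.\<close>

lemma lie_derivative_snoc:
  "\<Theta> k y \<phi> \<psi> (xs @ [z]) =
   \<Theta> k y (\<lambda>zs. \<phi> (zs @ [z])) (\<lambda>zs. \<psi> (zs @ [\<alpha> z])) xs - \<psi> (map \<alpha> xs @ [br z y])"
proof -
  have "(\<Sum>i<length xs. \<psi> ((map \<alpha> xs @ [\<alpha> z])[i := br ((xs @ [z]) ! i) y])) =
     (\<Sum>i<length xs. \<psi> ((map \<alpha> xs)[i := br (xs ! i) y] @ [\<alpha> z]))"
    by (rule sum.cong) (simp_all add: nth_append list_update_append1)
  then show ?thesis
    by (simp add: lie_derivative_def list_update_append)
qed

lemma lie_derivative_lincomb:
  "\<Theta> k y (\<lambda>zs. \<phi> zs + scaleM c (\<phi>' zs)) (\<lambda>zs. \<psi> zs + scaleM c (\<psi>' zs)) xs =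
   \<Theta> k y \<phi> \<psi> xs + scaleM c (\<Theta> k y \<phi>' \<psi>' xs)"
  by (simp add: lie_derivative_def ract_add_left ract_scale_left sum.distrib M.scale_sum_right
      M.scale_right_diff_distrib)

lemma twisted_coboundary_lincomb:
  assumes "xs \<noteq> []"
  shows "\<partial> k (\<lambda>zs. \<phi> zs + scaleM c (\<phi>' zs)) (\<lambda>zs. \<psi> zs + scaleM c (\<psi>' zs)) xs =
   \<partial> k \<phi> \<psi> xs + scaleM c (\<partial> k \<phi>' \<psi>' xs)"
  using assms
proof (induction xs arbitrary: \<phi> \<psi> \<phi>' \<psi>' rule: rev_nonempty_induct)
  case (single x)
  then show ?case by (simp add: twisted_coboundary_singleton lact_add_right lact_scale_right)
next
  case (snoc y xs)
  then show ?case
    by (simp add: twisted_coboundary_snoc lie_derivative_lincomb M.scale_right_distrib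
      M.scale_right_diff_distrib mult.commute)
qed

lemma lie_derivative_cong:
  assumes "\<And>zs. length zs = length xs \<Longrightarrow> \<phi> zs = \<phi>' zs"
    and "\<And>zs. length zs = length xs \<Longrightarrow> \<psi> zs = \<psi>' zs"
  shows "\<Theta> k y \<phi> \<psi> xs = \<Theta> k y \<phi>' \<psi>' xs"
  by (simp add: lie_derivative_def assms)

lemma twisted_coboundary_cong:
  assumes "xs \<noteq> []"
    and "\<And>zs. length xs = Suc (length zs) \<Longrightarrow> \<phi> zs = \<phi>' zs"
    and "\<And>zs. length xs = Suc (length zs) \<Longrightarrow> \<psi> zs = \<psi>' zs"
  shows "\<partial> k \<phi> \<psi> xs = \<partial> k \<phi>' \<psi>' xs"
  using assms
proof (induction xs arbitrary: \<phi> \<psi> \<phi>' \<psi>' rule: rev_nonempty_induct)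
  case (single x)
  then show ?case by (simp add: twisted_coboundary_singleton)
next
  case (snoc y xs)
  have "\<partial> k (\<lambda>zs. \<phi> (zs @ [y])) (\<lambda>zs. \<psi> (zs @ [\<alpha> y])) xs =
        \<partial> k (\<lambda>zs. \<phi>' (zs @ [y])) (\<lambda>zs. \<psi>' (zs @ [\<alpha> y])) xs"
    by (rule snoc.IH) (simp_all add: snoc.prems)
  moreover have "\<Theta> k y \<phi> \<psi> xs = \<Theta> k y \<phi>' \<psi>' xs"
    by (rule lie_derivative_cong) (simp_all add: snoc.prems)
  ultimately show ?case using snoc.hyps by (simp add: twisted_coboundary_snoc)
qed

text \<open>Precomposing both members of a pair with \<open>\<alpha>\<close> in all arguments amounts to evaluating at the twisted
  tuple, at the price of one power of \<open>\<alpha>\<close>; this and its analogue for \<open>\<partial>\<close> handle the term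
  \<open>\<psi> (map \<alpha> xs @ [br z y])\<close> that the insertion rule for the Lie derivative produces.\<close>

lemma lie_derivative_map:
  "\<Theta> (Suc k) y (\<lambda>zs. \<phi> (map \<alpha> zs)) (\<lambda>zs. \<psi> (map \<alpha> zs)) xs = \<Theta> k (\<alpha> y) \<phi> \<psi> (map \<alpha> xs)"
  by (simp add: lie_derivative_def \<alpha>_pow_\<alpha> map_update \<alpha>_br)

lemma twisted_coboundary_map:
  assumes "xs \<noteq> []"
  shows "\<partial> (Suc k) (\<lambda>zs. \<phi> (map \<alpha> zs)) (\<lambda>zs. \<psi> (map \<alpha> zs)) xs = \<partial> k \<phi> \<psi> (map \<alpha> xs)"
  using assms
proof (induction xs arbitrary: \<phi> \<psi> rule: rev_nonempty_induct)
  case (single x)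
  then show ?case by (simp add: twisted_coboundary_singleton \<alpha>_pow_\<alpha>)
next
  case (snoc y xs)
  then show ?case
    using snoc.IH[of "\<lambda>zs. \<phi> (zs @ [\<alpha> y])" "\<lambda>zs. \<psi> (zs @ [\<alpha> (\<alpha> y)])"]
    by (simp add: twisted_coboundary_snoc lie_derivative_map)
qed

section \<open>Intertwined pairs\<close>

definition intertwined :: "nat \<Rightarrow> ('l list \<Rightarrow> 'm) \<Rightarrow> ('l list \<Rightarrow> 'm) \<Rightarrow> bool" where
  "intertwined n \<phi> \<psi> \<longleftrightarrow> (\<forall>xs. length xs = n \<longrightarrow> \<gamma> (\<phi> xs) = \<psi> (map \<alpha> xs))"

lemma intertwinedD: "intertwined n \<phi> \<psi> \<Longrightarrow> length xs = n \<Longrightarrow> \<psi> (map \<alpha> xs) = \<gamma> (\<phi> xs)"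
  by (simp add: intertwined_def)

text \<open>This stability is the reason for working with pairs: it fails for the condition
  \<open>intertwined n \<phi> \<phi>\<close> that defines cochains.\<close>

lemma intertwined_snoc:
  "intertwined (Suc n) \<phi> \<psi> \<Longrightarrow> intertwined n (\<lambda>zs. \<phi> (zs @ [y])) (\<lambda>zs. \<psi> (zs @ [\<alpha> y]))"
  by (simp add: intertwined_def)

lemma multilinear_snoc:
  "multilinear scaleL scaleM (Suc n) \<phi> \<Longrightarrow> multilinear scaleL scaleM n (\<lambda>zs. \<phi> (zs @ [y]))"
  unfolding multilinear_def
proof (intro allI impI)
  fix xs :: "'l list" and k
  assume "\<forall>xs k. length xs = Suc n \<longrightarrow> k < Suc n \<longrightarrow>
      Vector_Spaces.linear scaleL scaleM (\<lambda>x. \<phi> (xs[k := x]))"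
    and "length xs = n" "k < n"
  then have "Vector_Spaces.linear scaleL scaleM (\<lambda>x. \<phi> ((xs @ [y])[k := x]))"
    by simp
  then show "Vector_Spaces.linear scaleL scaleM (\<lambda>x. \<phi> (xs[k := x] @ [y]))"
    using \<open>length xs = n\<close> \<open>k < n\<close> by (simp add: list_update_append1)
qed

lemma multilinear_iff:
  "multilinear scaleL scaleM n \<phi> \<longleftrightarrow>
    (\<forall>xs k. length xs = n \<longrightarrow> k < n \<longrightarrow>
      (\<forall>x y. \<phi> (xs[k := x + y]) = \<phi> (xs[k := x]) + \<phi> (xs[k := y])) \<and>
      (\<forall>c x. \<phi> (xs[k := scaleL c x]) = scaleM c (\<phi> (xs[k := x]))))"
  unfolding multilinear_def Vector_Spaces.linear_iff
  by (simp add: M.vector_space_axioms vector_space_axioms)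

lemma intertwined_lie_derivative:
  assumes "intertwined n \<phi> \<psi>" "intertwined n \<psi> \<chi>"
  shows "intertwined n (\<Theta> k y \<phi> \<psi>) (\<Theta> k (\<alpha> y) \<psi> \<chi>)"
  unfolding intertwined_def
proof (intro allI impI)
  fix xs :: "'l list" assume n: "length xs = n"
  show "\<gamma> (\<Theta> k y \<phi> \<psi> xs) = \<Theta> k (\<alpha> y) \<psi> \<chi> (map \<alpha> xs)"
    using intertwinedD[OF assms(1) n] intertwinedD[OF assms(2)] n
    by (simp add: lie_derivative_def \<gamma>_diff \<gamma>_sum \<alpha>_pow_\<alpha> \<gamma>_ract map_update \<alpha>_br
        intertwinedD[OF assms(2), symmetric])
qed

lemma intertwined_twisted_coboundary:
  assumes "intertwined n \<phi> \<psi>" "intertwined n \<psi> \<chi>"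
  shows "intertwined (Suc n) (\<partial> k \<phi> \<psi>) (\<partial> k \<psi> \<chi>)"
proof -
  have "\<gamma> (\<partial> k \<phi> \<psi> xs) = \<partial> k \<psi> \<chi> (map \<alpha> xs)" 
    if "xs \<noteq> []" "length xs = Suc n" for xs
    using that assms
  proof (induction xs arbitrary: n \<phi> \<psi> \<chi> rule: rev_nonempty_induct)
    case (single x)
    then show ?case
      using intertwinedD[of n \<phi> \<psi> "[]"] by (simp add: twisted_coboundary_singleton \<alpha>_pow_\<alpha> \<gamma>_lact)
  next
    case (snoc y xs)
    obtain m where m: "n = Suc m" "length xs = Suc m"
      using snoc.hyps snoc.prems(1) by (cases n) auto
    have "\<gamma> (\<partial> k (\<lambda>zs. \<phi> (zs @ [y])) (\<lambda>zs. \<psi> (zs @ [\<alpha> y])) xs) =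
      \<partial> k (\<lambda>zs. \<psi> (zs @ [\<alpha> y])) (\<lambda>zs. \<chi> (zs @ [\<alpha> (\<alpha> y)])) (map \<alpha> xs)"
      by (rule snoc.IH[of m]) (use snoc.prems m in \<open>simp_all add: intertwined_snoc\<close>)
    moreover have "\<gamma> (\<Theta> k y \<phi> \<psi> xs) = \<Theta> k (\<alpha> y) \<psi> \<chi> (map \<alpha> xs)"
      using intertwinedD[OF intertwined_lie_derivative[OF snoc.prems(2,3)], of xs] m by simp
    ultimately show ?case using snoc.hyps by (simp add: twisted_coboundary_snoc \<gamma>_diff \<gamma>_scale)
  qed
  then show ?thesis unfolding intertwined_def by (metis length_0_conv nat.distinct(1))
qed

section \<open>Commutation relations\<close>

text \<open>In the double sum over the positions at which \<open>z\<close> and \<open>y\<close> act, terms at distinct positions are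
  symmetric because \<open>\<alpha>\<close> preserves brackets. At equal positions the Leibniz identity gives
  \<open>[[x, z], \<alpha> y] - [[x, y], \<alpha> z] = [\<alpha> x, [z, y]]\<close>. The mixed terms, where one element acts on the value
  and the other on an argument, are symmetric, and the double action on the value is the axiom for
  \<open>[m, [z, y]]\<close>, which applies since \<open>\<psi>\<close> at the twisted tuple is \<open>\<gamma>\<close> of a value of \<open>\<phi>\<close>.\<close>

lemma lie_derivative_commutator:
  assumes "intertwined n \<phi> \<psi>" and "multilinear scaleL scaleM n \<chi>" and n: "length xs = n"
  shows "\<Theta> (Suc k) z (\<Theta> k y \<phi> \<psi>) (\<Theta> k (\<alpha> y) \<psi> \<chi>) xs =
    \<Theta> (Suc k) y (\<Theta> k z \<phi> \<psi>) (\<Theta> k (\<alpha> z) \<psi> \<chi>) xs - \<Theta> k (br z y) \<psi> \<chi> (map \<alpha> xs)"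
proof -
  let ?c = "\<lambda>y xs i. (map \<alpha> xs)[i := br (xs ! i) y]"
  define f where "f y z i j = \<chi> (?c (\<alpha> y) (?c z xs i) j)" for y z i j
  define h where "h i = \<chi> (?c (br z y) (map \<alpha> xs) i)" for i
  have off: "f y z i j = f z y j i" if "i \<noteq> j" "i < n" "j < n" for i j
  proof -
    have "?c (\<alpha> y) (?c z xs i) j = ?c (\<alpha> z) (?c y xs j) i"
      using that n by (simp add: map_update \<alpha>_br list_update_swap)
    then show ?thesis by (simp add: f_def)
  qed
  have diag: "f y z i i = f z y i i + h i" if "i < n" for i
  proof -
    let ?u = "map \<alpha> (map \<alpha> xs)"
    have "f y z i i = \<chi> (?u[i := br (br (xs ! i) z) (\<alpha> y)])"
         "f z y i i = \<chi> (?u[i := br (br (xs ! i) y) (\<alpha> z)])"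
         "h i = \<chi> (?u[i := br (\<alpha> (xs ! i)) (br z y)])"
      using that n by (simp_all add: f_def h_def map_update)
    moreover have "br (br (xs ! i) z) (\<alpha> y) =
        br (br (xs ! i) y) (\<alpha> z) + br (\<alpha> (xs ! i)) (br z y)"
      by (simp add: hom_leibniz)
    ultimately show ?thesis
      using assms(2) that n unfolding multilinear_iff by (simp del: map_map)
  qed
  have "(\<Sum>i<n. \<Sum>j<n. f y z i j) = (\<Sum>i<n. \<Sum>j<n. f z y j i + (if i = j then h i else 0))"
    by (intro sum.cong refl) (use off diag in auto)
  also have "\<dots> = (\<Sum>i<n. \<Sum>j<n. f z y j i) + (\<Sum>i<n. h i)"
    by (simp add: sum.distrib)
  also have "(\<Sum>i<n. \<Sum>j<n. f z y j i) = (\<Sum>i<n. \<Sum>j<n. f z y i j)"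
    by (rule sum.swap)
  finally have ff: "(\<Sum>i<n. \<Sum>j<n. f y z i j) = (\<Sum>i<n. \<Sum>j<n. f z y i j) + (\<Sum>i<n. h i)" .
  have expand: "\<Theta> (Suc k) z (\<Theta> k y \<phi> \<psi>) (\<Theta> k (\<alpha> y) \<psi> \<chi>) xs =
      ract (ract (\<phi> xs) ((\<alpha> ^^ k) y)) (\<alpha> ((\<alpha> ^^ k) z))
      - (\<Sum>i<n. ract (\<psi> (?c y xs i)) (\<alpha> ((\<alpha> ^^ k) z)))
      - (\<Sum>i<n. ract (\<psi> (?c z xs i)) (\<alpha> ((\<alpha> ^^ k) y)))
      + (\<Sum>i<n. \<Sum>j<n. f y z i j)" for y z
    using n by (simp add: lie_derivative_def f_def ract_diff_left ract_sum_left sum_subtractf \<alpha>_pow_\<alpha>)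
  have "\<Theta> k (br z y) \<psi> \<chi> (map \<alpha> xs) =
     ract (\<gamma> (\<phi> xs)) (br ((\<alpha> ^^ k) z) ((\<alpha> ^^ k) y)) - (\<Sum>i<n. h i)"
    using n intertwinedD[OF assms(1) n] by (simp add: lie_derivative_def h_def \<alpha>_pow_br)
  then show ?thesis
    unfolding expand[of z y] expand[of y z] ff rep_MLL by (simp add: algebra_simps)
qed

text \<open>Inserting a last argument \<open>z\<close> leaves on the left, besides the induction hypothesis, the coboundary
  of the pair with \<open>[z, y]\<close> inserted and the commutator of \<open>\<Theta>\<^sub>z\<close> and \<open>\<Theta>\<^sub>y\<close>. The value \<open>\<Theta>\<^bsub>[z, y]\<^esub>\<close> of the
  commutator completes that coboundary to the one on the tuple ending in \<open>[z, y]\<close>, which is what the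
  insertion rule produces on the right. On one argument the claim is the axiom for \<open>[x, [m, y]]\<close>.\<close>

lemma twisted_coboundary_lie_derivative:
  assumes "length xs = Suc n" "intertwined n \<phi> \<psi>" "intertwined n \<psi> \<chi>"
    "multilinear scaleL scaleM n \<chi>"
  shows "\<partial> (Suc k) (\<Theta> k y \<phi> \<psi>) (\<Theta> k (\<alpha> y) \<psi> \<chi>) xs = \<Theta> (Suc k) y (\<partial> k \<phi> \<psi>) (\<partial> k \<psi> \<chi>) xs"
proof -
  from assms(1) have "xs \<noteq> []" by auto
  then show ?thesis
    using assms
  proof (induction xs arbitrary: n \<phi> \<psi> \<chi> rule: rev_nonempty_induct)
    case (single x)
    then have "\<psi> [] = \<gamma> (\<phi> [])" using intertwinedD[of n \<phi> \<psi> "[]"] by simp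
    then show ?case
      by (simp add: twisted_coboundary_singleton lie_derivative_def rep_LML \<alpha>_pow_\<alpha> \<alpha>_pow_br)
  next
    case (snoc z xs)
    obtain m where m: "n = Suc m" "length xs = Suc m"
      using snoc.hyps snoc.prems(1) by (cases n) auto
    let ?\<phi> = "\<lambda>zs. \<phi> (zs @ [z])" and ?\<psi> = "\<lambda>zs. \<psi> (zs @ [\<alpha> z])" and ?\<chi> = "\<lambda>zs. \<chi> (zs @ [\<alpha> (\<alpha> z)])"
    let ?s = "(-1 :: 'k) ^ Suc (length xs)"
    have IH: "\<partial> (Suc k) (\<Theta> k y ?\<phi> ?\<psi>) (\<Theta> k (\<alpha> y) ?\<psi> ?\<chi>) xs = \<Theta> (Suc k) y (\<partial> k ?\<phi> ?\<psi>) (\<partial> k ?\<psi> ?\<chi>) xs"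
      by (rule snoc.IH[of m])
        (use snoc.prems m in \<open>simp_all add: intertwined_snoc multilinear_snoc\<close>)
    let ?w = "br z y"
    have len: "length xs = n" using m by simp
    \<comment> \<open>The minus sign of the insertion rule is written as a coefficient \<open>-1\<close> so that both members of the
      pair have the form to which linearity of \<open>\<partial>\<close> applies.\<close>
    have "\<partial> (Suc k) (\<Theta> k y \<phi> \<psi>) (\<Theta> k (\<alpha> y) \<psi> \<chi>) (xs @ [z]) =
       \<partial> (Suc k) (\<lambda>zs. \<Theta> k y ?\<phi> ?\<psi> zs + scaleM (-1) (\<psi> (map \<alpha> zs @ [?w])))
         (\<lambda>zs. \<Theta> k (\<alpha> y) ?\<psi> ?\<chi> zs + scaleM (-1) (\<chi> (map \<alpha> zs @ [\<alpha> ?w]))) xs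
       + scaleM ?s (\<Theta> (Suc k) z (\<Theta> k y \<phi> \<psi>) (\<Theta> k (\<alpha> y) \<psi> \<chi>) xs)"
      unfolding twisted_coboundary_snoc[OF snoc.hyps, of "Suc k"]
      by (simp add: lie_derivative_snoc \<alpha>_br)
    also have "\<dots> = \<Theta> (Suc k) y (\<partial> k ?\<phi> ?\<psi>) (\<partial> k ?\<psi> ?\<chi>) xs
         - \<partial> k (\<lambda>zs. \<psi> (zs @ [?w])) (\<lambda>zs. \<chi> (zs @ [\<alpha> ?w])) (map \<alpha> xs)
       + scaleM ?s (\<Theta> (Suc k) y (\<Theta> k z \<phi> \<psi>) (\<Theta> k (\<alpha> z) \<psi> \<chi>) xs - \<Theta> k ?w \<psi> \<chi> (map \<alpha> xs))"
      unfolding twisted_coboundary_lincomb[OF snoc.hyps] IH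
        twisted_coboundary_map[OF snoc.hyps, of k "\<lambda>zs. \<psi> (zs @ [?w])" "\<lambda>zs. \<chi> (zs @ [\<alpha> ?w])"]
        lie_derivative_commutator[OF snoc.prems(2,4) len, of k z y]
      by simp
    also have "\<dots> = \<Theta> (Suc k) y (\<lambda>zs. \<partial> k ?\<phi> ?\<psi> zs + scaleM ?s (\<Theta> k z \<phi> \<psi> zs))
          (\<lambda>zs. \<partial> k ?\<psi> ?\<chi> zs + scaleM ?s (\<Theta> k (\<alpha> z) \<psi> \<chi> zs)) xs
        - \<partial> k \<psi> \<chi> (map \<alpha> xs @ [?w])"
      unfolding lie_derivative_lincomb using snoc.hyps
      by (simp add: twisted_coboundary_snoc M.scale_right_diff_distrib algebra_simps)
    also have "\<Theta> (Suc k) y (\<lambda>zs. \<partial> k ?\<phi> ?\<psi> zs + scaleM ?s (\<Theta> k z \<phi> \<psi> zs))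
          (\<lambda>zs. \<partial> k ?\<psi> ?\<chi> zs + scaleM ?s (\<Theta> k (\<alpha> z) \<psi> \<chi> zs)) xs =
        \<Theta> (Suc k) y (\<lambda>zs. \<partial> k \<phi> \<psi> (zs @ [z])) (\<lambda>zs. \<partial> k \<psi> \<chi> (zs @ [\<alpha> z])) xs"
    proof (rule lie_derivative_cong)
      fix zs :: "'l list" assume l: "length zs = length xs"
      then have "zs \<noteq> []" using snoc.hyps by auto
      then show "\<partial> k ?\<phi> ?\<psi> zs + scaleM ?s (\<Theta> k z \<phi> \<psi> zs) = \<partial> k \<phi> \<psi> (zs @ [z])"
        and "\<partial> k ?\<psi> ?\<chi> zs + scaleM ?s (\<Theta> k (\<alpha> z) \<psi> \<chi> zs) = \<partial> k \<psi> \<chi> (zs @ [\<alpha> z])"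
        using l by (simp_all add: twisted_coboundary_snoc)
    qed
    finally show ?case by (simp add: lie_derivative_snoc)
  qed
qed

text \<open>Splitting off \<open>y\<close> in the outer and in the inner coboundary produces \<open>\<partial>\<Theta>\<^sub>y\<close> and \<open>\<Theta>\<^sub>y\<partial>\<close> with opposite
  signs, because the inner tuple is one shorter, and they cancel by the previous lemma. On two arguments the
  claim is the axiom for \<open>[x, [y, m]]\<close>.\<close>

lemma twisted_coboundary_squared:
  assumes "length xs = Suc n" "intertwined n \<phi> \<psi>" "intertwined n \<psi> \<chi>"
    "multilinear scaleL scaleM n \<chi>"
  shows "\<partial> (Suc k) (\<partial> k \<phi> \<psi>) (\<partial> k \<psi> \<chi>) (xs @ [y]) = 0"
proof -
  from assms(1) have "xs \<noteq> []" by auto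
  then show ?thesis
    using assms
  proof (induction xs arbitrary: n \<phi> \<psi> \<chi> y rule: rev_nonempty_induct)
    case (single x)
    then have "\<psi> [] = \<gamma> (\<phi> [])" using intertwinedD[of n \<phi> \<psi> "[]"] by simp
    then show ?case
      unfolding twisted_coboundary_snoc[OF list.distinct(2)[of x "[]"]] twisted_coboundary_singleton
      by (simp add: twisted_coboundary_singleton lie_derivative_def rep_LLM \<alpha>_pow_\<alpha> \<alpha>_pow_br)
  next
    case (snoc z xs)
    obtain m where m: "n = Suc m" "length xs = Suc m"
      using snoc.hyps snoc.prems(1) by (cases n) auto
    let ?\<phi> = "\<lambda>zs. \<phi> (zs @ [y])" and ?\<psi> = "\<lambda>zs. \<psi> (zs @ [\<alpha> y])" and ?\<chi> = "\<lambda>zs. \<chi> (zs @ [\<alpha> (\<alpha> y)])"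
    let ?ys = "xs @ [z]"
    let ?s = "(-1 :: 'k) ^ Suc n"
    have ys: "?ys \<noteq> []" by simp
    have IH: "\<partial> (Suc k) (\<partial> k ?\<phi> ?\<psi>) (\<partial> k ?\<psi> ?\<chi>) ?ys = 0"
      by (rule snoc.IH[of m])
        (use snoc.prems m in \<open>simp_all add: intertwined_snoc multilinear_snoc\<close>)
    have "\<partial> (Suc k) (\<partial> k \<phi> \<psi>) (\<partial> k \<psi> \<chi>) (?ys @ [y]) =
      \<partial> (Suc k) (\<lambda>zs. \<partial> k \<phi> \<psi> (zs @ [y])) (\<lambda>zs. \<partial> k \<psi> \<chi> (zs @ [\<alpha> y])) ?ys
      + scaleM (- ?s) (\<Theta> (Suc k) y (\<partial> k \<phi> \<psi>) (\<partial> k \<psi> \<chi>) ?ys)"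
      unfolding twisted_coboundary_snoc[OF ys] using m by simp
    also have "\<partial> (Suc k) (\<lambda>zs. \<partial> k \<phi> \<psi> (zs @ [y])) (\<lambda>zs. \<partial> k \<psi> \<chi> (zs @ [\<alpha> y])) ?ys =
      \<partial> (Suc k) (\<lambda>zs. \<partial> k ?\<phi> ?\<psi> zs + scaleM ?s (\<Theta> k y \<phi> \<psi> zs))
        (\<lambda>zs. \<partial> k ?\<psi> ?\<chi> zs + scaleM ?s (\<Theta> k (\<alpha> y) \<psi> \<chi> zs)) ?ys"
    proof (rule twisted_coboundary_cong)
      fix zs :: "'l list" assume "length ?ys = Suc (length zs)"
      then have "zs \<noteq> []" "length zs = n" using m by auto
      then show "\<partial> k \<phi> \<psi> (zs @ [y]) = \<partial> k ?\<phi> ?\<psi> zs + scaleM ?s (\<Theta> k y \<phi> \<psi> zs)"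
        and "\<partial> k \<psi> \<chi> (zs @ [\<alpha> y]) = \<partial> k ?\<psi> ?\<chi> zs + scaleM ?s (\<Theta> k (\<alpha> y) \<psi> \<chi> zs)"
        by (simp_all add: twisted_coboundary_snoc)
    qed simp
    also have "\<dots> = scaleM ?s (\<Theta> (Suc k) y (\<partial> k \<phi> \<psi>) (\<partial> k \<psi> \<chi>) ?ys)"
      unfolding twisted_coboundary_lincomb[OF ys] IH
        twisted_coboundary_lie_derivative[OF snoc.prems(1-4)]
      by simp
    finally show ?case by simp
  qed
qed

section \<open>Multilinearity\<close>

lemma multilinear_lie_derivative:
  assumes "multilinear scaleL scaleM n \<phi>" "multilinear scaleL scaleM n \<psi>"
  shows "multilinear scaleL scaleM n (\<Theta> k y \<phi> \<psi>)"
  unfolding multilinear_def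
proof (intro allI impI)
  fix xs :: "'l list" and p assume n: "length xs = n" "p < n"
  have lin: "Vector_Spaces.linear scaleL scaleM (\<lambda>x. \<omega> (xs[p := x]))"
    if "multilinear scaleL scaleM n \<omega>" "length xs = n" for \<omega> xs
    using that n unfolding multilinear_def by blast
  have "Vector_Spaces.linear scaleL scaleM
      (\<lambda>x. \<psi> ((map \<alpha> (xs[p := x]))[i := br (xs[p := x] ! i) y]))" if "i < n" for i
  proof (cases "i = p")
    case True
    then show ?thesis
      using lin[OF assms(2), of "map \<alpha> xs"] n
      by (simp add: Vector_Spaces.linear_iff map_update br_add_left br_scale_left)
  next
    case False
    then have "(map \<alpha> (xs[p := x]))[i := br (xs[p := x] ! i) y] =
       ((map \<alpha> xs)[i := br (xs ! i) y])[p := \<alpha> x]" for x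
      by (simp add: map_update list_update_swap)
    then show ?thesis
      using lin[OF assms(2), of "(map \<alpha> xs)[i := br (xs ! i) y]"] n
      by (simp add: Vector_Spaces.linear_iff \<alpha>_add \<alpha>_scale)
  qed
  then show "Vector_Spaces.linear scaleL scaleM (\<lambda>x. \<Theta> k y \<phi> \<psi> (xs[p := x]))"
    using lin[OF assms(1) n(1)] n unfolding lie_derivative_def
    by (simp add: Vector_Spaces.linear_iff ract_add_left ract_scale_left sum.distrib M.scale_sum_right
      M.scale_right_diff_distrib)
qed

lemma lie_derivative_linear_direction:
  "\<Theta> k (y + y') \<phi> \<psi> xs = \<Theta> k y \<phi> \<psi> xs + \<Theta> k y' \<phi> \<psi> xs"
  "\<Theta> k (scaleL c y) \<phi> \<psi> xs = scaleM c (\<Theta> k y \<phi> \<psi> xs)"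
  if "multilinear scaleL scaleM (length xs) \<psi>"
  using that unfolding multilinear_iff lie_derivative_def
  by (simp_all add: \<alpha>_pow_add \<alpha>_pow_scale ract_add_right ract_scale_right br_add_right
      br_scale_right sum.distrib M.scale_sum_right M.scale_right_diff_distrib)

lemma twisted_coboundary_add:
  "xs \<noteq> [] \<Longrightarrow>
    \<partial> k (\<lambda>zs. \<phi> zs + \<phi>' zs) (\<lambda>zs. \<psi> zs + \<psi>' zs) xs = \<partial> k \<phi> \<psi> xs + \<partial> k \<phi>' \<psi>' xs"
  using twisted_coboundary_lincomb[of xs k \<phi> 1 \<phi>' \<psi> \<psi>'] by simp

lemma twisted_coboundary_scale:
  "xs \<noteq> [] \<Longrightarrow>
    \<partial> k (\<lambda>zs. scaleM c (\<phi> zs)) (\<lambda>zs. scaleM c (\<psi> zs)) xs = scaleM c (\<partial> k \<phi> \<psi> xs)"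
  \<comment> \<open>the second instance, with coefficient \<open>-1\<close>, says that the coboundary of the zero pair vanishes\<close>
  using twisted_coboundary_lincomb[of xs k "\<lambda>_. 0" c \<phi> "\<lambda>_. 0" \<psi>]
    twisted_coboundary_lincomb[of xs k "\<lambda>_. 0" "-1" "\<lambda>_. 0" "\<lambda>_. 0" "\<lambda>_. 0"]
  by simp

text \<open>Linearity in the last slot is not an instance of the induction hypothesis: it comes from linearity
  of \<open>\<partial>\<close> in the pair and of \<open>\<Theta>\<^sub>y\<close> in \<open>y\<close>.\<close>

lemma multilinear_twisted_coboundary:
  assumes "multilinear scaleL scaleM n \<phi>" "multilinear scaleL scaleM n \<psi>"
  shows "multilinear scaleL scaleM (Suc n) (\<partial> k \<phi> \<psi>)"
proof -
  have "Vector_Spaces.linear scaleL scaleM (\<lambda>x. \<partial> k \<phi> \<psi> (xs[p := x]))"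
    if "xs \<noteq> []" "length xs = Suc n" "p < Suc n" for xs p
    using that assms
  proof (induction xs arbitrary: n p \<phi> \<psi> rule: rev_nonempty_induct)
    case (single x)
    then show ?case
      using M.vector_space_axioms vector_space_axioms
      by (simp add: Vector_Spaces.linear_iff twisted_coboundary_singleton \<alpha>_pow_add \<alpha>_pow_scale
        lact_add_left lact_scale_left)
  next
    case (snoc y xs)
    obtain m where m: "n = Suc m" "length xs = Suc m"
      using snoc.hyps snoc.prems(1) by (cases n) auto
    show ?case
    proof (cases "p < n")
      case True
      have "Vector_Spaces.linear scaleL scaleM
          (\<lambda>x. \<partial> k (\<lambda>zs. \<phi> (zs @ [y])) (\<lambda>zs. \<psi> (zs @ [\<alpha> y])) (xs[p := x]))"
        by (rule snoc.IH[of m]) (use snoc.prems True m in \<open>simp_all add: multilinear_snoc\<close>)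
      moreover have "Vector_Spaces.linear scaleL scaleM (\<lambda>x. \<Theta> k y \<phi> \<psi> (xs[p := x]))"
        using multilinear_lie_derivative[OF snoc.prems(3,4)] True m unfolding multilinear_def by simp
      ultimately show ?thesis
        using True m snoc.hyps
        by (simp add: list_update_append1 twisted_coboundary_snoc Vector_Spaces.linear_iff
          M.scale_right_distrib algebra_simps)
    next
      case False
      then have p: "p = length xs" using snoc.prems m by simp
      \<comment> \<open>\<open>m = n - 1\<close> is the last position of an \<open>n\<close>-tuple; the entry \<open>0\<close> below is a placeholder there.\<close>
      have last: "\<omega> (zs @ [x + y]) = \<omega> (zs @ [x]) + \<omega> (zs @ [y])"
        "\<omega> (zs @ [scaleL c x]) = scaleM c (\<omega> (zs @ [x]))"
        if "multilinear scaleL scaleM n \<omega>" "length xs = Suc (length zs)" for \<omega> zs x y c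
      proof -
        have "\<forall>x. (zs @ [0])[m := x] = zs @ [x]" "length (zs @ [0]) = n" "m < n"
          using that(2) m by auto
        then show "\<omega> (zs @ [x + y]) = \<omega> (zs @ [x]) + \<omega> (zs @ [y])"
          "\<omega> (zs @ [scaleL c x]) = scaleM c (\<omega> (zs @ [x]))"
          using that(1) unfolding multilinear_iff by metis+
      qed
      let ?L = "\<lambda>y. \<partial> k (\<lambda>zs. \<phi> (zs @ [y])) (\<lambda>zs. \<psi> (zs @ [\<alpha> y])) xs"
      have "?L (y + y') = ?L y + ?L y'" for y y'
        unfolding twisted_coboundary_add[OF snoc.hyps, symmetric]
        by (rule twisted_coboundary_cong[OF snoc.hyps])
           (simp_all add: last[OF snoc.prems(3)] last[OF snoc.prems(4)] \<alpha>_add)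
      moreover have "?L (scaleL c y) = scaleM c (?L y)" for y c
        unfolding twisted_coboundary_scale[OF snoc.hyps, symmetric]
        by (rule twisted_coboundary_cong[OF snoc.hyps])
           (simp_all add: last[OF snoc.prems(3)] last[OF snoc.prems(4)] \<alpha>_scale)
      moreover have "multilinear scaleL scaleM (length xs) \<psi>"
        using snoc.prems(4) m by simp
      ultimately show ?thesis
        using p snoc.hyps M.vector_space_axioms vector_space_axioms
        by (simp add: twisted_coboundary_snoc Vector_Spaces.linear_iff
          lie_derivative_linear_direction M.scale_right_distrib
          M.scale_right_diff_distrib mult.commute)
    qed
  qed
  then show ?thesis unfolding multilinear_def by (metis length_0_conv nat.distinct(1))
qed

section \<open>The cochain complex\<close>

abbreviation "C n \<equiv> cochains scaleL \<alpha> scaleM \<gamma> n"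
abbreviation "\<delta> n \<equiv> coboundary br \<alpha> scaleM lact ract n"

lemma coboundary_eq_twisted_coboundary: "\<delta> n \<phi> xs = (if length xs = n + 1 then \<partial> (n - 1) \<phi> \<phi> xs else 0)"
  by (simp add: coboundary_def twisted_coboundary_def)

lemma cochains_iff: "\<phi> \<in> C n \<longleftrightarrow> multilinear scaleL scaleM n \<phi> \<and> intertwined n \<phi> \<phi> \<and>
    (\<forall>xs. length xs \<noteq> n \<longrightarrow> \<phi> xs = 0)"
  by (simp add: cochains_def intertwined_def)

lemma coboundary_cochain:
  assumes "\<phi> \<in> C n"
  shows "\<delta> n \<phi> \<in> C (n + 1)"
  using assms multilinear_twisted_coboundary[of n \<phi> \<phi> "n - 1"] intertwined_twisted_coboundary[of n \<phi> \<phi> \<phi> "n - 1"]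
  by (simp add: cochains_iff intertwined_def multilinear_def coboundary_eq_twisted_coboundary)

lemma coboundary_coboundary:
  assumes "n \<ge> 1" "\<phi> \<in> C n"
  shows "\<delta> (n + 1) (\<delta> n \<phi>) = 0"
proof
  fix xs
  show "\<delta> (n + 1) (\<delta> n \<phi>) xs = 0 xs"
  proof (cases "length xs = n + 2")
    case True
    then obtain ys y where ys: "xs = ys @ [y]" "length ys = Suc n" "ys \<noteq> []"
      by (cases xs rule: rev_cases) fastforce+
    have "\<delta> (n + 1) (\<delta> n \<phi>) xs = \<partial> n (\<delta> n \<phi>) (\<delta> n \<phi>) xs"
      using True by (simp add: coboundary_eq_twisted_coboundary)
    \<comment> \<open>By \<open>n \<ge> 1\<close> the outer exponent \<open>n\<close> is one more than the inner exponent \<open>n - 1\<close>.\<close>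
    also have "\<dots> = \<partial> (Suc (n - 1)) (\<partial> (n - 1) \<phi> \<phi>) (\<partial> (n - 1) \<phi> \<phi>) xs"
      using assms(1) True by (simp, intro twisted_coboundary_cong) (auto simp: coboundary_eq_twisted_coboundary)
    also have "\<dots> = 0"
      unfolding ys(1) by (rule twisted_coboundary_squared) (use ys assms in \<open>auto simp: cochains_iff\<close>)
    finally show ?thesis by simp
  qed (simp add: coboundary_eq_twisted_coboundary)
qed

lemma vector_space_scale_fun: "vector_space (scale_fun scaleM :: 'k \<Rightarrow> ('x \<Rightarrow> 'm) \<Rightarrow> 'x \<Rightarrow> 'm)"
  by unfold_locales
    (auto simp: scale_fun_def fun_eq_iff M.scale_right_distrib M.scale_left_distrib)

lemma subspace_cochains: "module.subspace (scale_fun scaleM) (C n)"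
proof -
  interpret F: vector_space "scale_fun scaleM :: 'k \<Rightarrow> ('l list \<Rightarrow> 'm) \<Rightarrow> _"
    by (rule vector_space_scale_fun)
  have "\<gamma> 0 = 0" using \<gamma>_diff[of 0 0] by simp
  then show ?thesis
    unfolding F.subspace_def
    by (auto simp: cochains_iff intertwined_def multilinear_iff scale_fun_def \<gamma>_add \<gamma>_scale
        M.scale_right_distrib M.scale_left_commute)
qed

lemma coboundary_add: "\<delta> n (\<phi> + \<psi>) = \<delta> n \<phi> + \<delta> n \<psi>"
proof
  fix xs show "\<delta> n (\<phi> + \<psi>) xs = (\<delta> n \<phi> + \<delta> n \<psi>) xs"
    using twisted_coboundary_add[of xs "n - 1" \<phi> \<psi> \<phi> \<psi>]
    by (cases xs) (simp_all add: coboundary_eq_twisted_coboundary plus_fun_def)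
qed

lemma coboundary_scale: "\<delta> n (scale_fun scaleM c \<phi>) = scale_fun scaleM c (\<delta> n \<phi>)"
proof
  fix xs show "\<delta> n (scale_fun scaleM c \<phi>) xs = scale_fun scaleM c (\<delta> n \<phi>) xs"
    using twisted_coboundary_scale[of xs "n - 1" c \<phi> \<phi>]
    by (cases xs) (simp_all add: coboundary_eq_twisted_coboundary scale_fun_def)
qed

lemma cochain_complex_coboundary: "cochain_complex (scale_fun scaleM) C \<delta>"
  unfolding cochain_complex_def
  using vector_space_scale_fun subspace_cochains coboundary_cochain coboundary_add
    coboundary_scale coboundary_coboundary
  by blast

end

theorem proposition1p4:
  fixes scaleL :: "'k::{alg_closed_field, field_char_0} \<Rightarrow> 'l::ab_group_add \<Rightarrow> 'l"
    and br :: "'l \<Rightarrow> 'l \<Rightarrow> 'l"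
    and \<alpha> :: "'l \<Rightarrow> 'l"
    and scaleM :: "'k \<Rightarrow> 'm::ab_group_add \<Rightarrow> 'm"
    and \<gamma> :: "'m \<Rightarrow> 'm"
    and lact :: "'l \<Rightarrow> 'm \<Rightarrow> 'm"
    and ract :: "'m \<Rightarrow> 'l \<Rightarrow> 'm"
  assumes "hom_leibniz_algebra scaleL br \<alpha>"
    and "hom_leibniz_representation scaleL br \<alpha> scaleM \<gamma> lact ract"
  shows "(\<forall>n\<ge>1. \<forall>\<phi> \<in> cochains scaleL \<alpha> scaleM \<gamma> n.
            coboundary br \<alpha> scaleM lact ract (n + 1)
              (coboundary br \<alpha> scaleM lact ract n \<phi>) = 0) \<and>
         cochain_complex (scale_fun scaleM)
           (cochains scaleL \<alpha> scaleM \<gamma>) (coboundary br \<alpha> scaleM lact ract)"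
proof -
  interpret hom_leibniz_representation scaleL br \<alpha> scaleM \<gamma> lact ract
    by (rule assms(2))
  show ?thesis
    using coboundary_coboundary cochain_complex_coboundary by blast
qed

end
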